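(* (The Vertex-Cut Bound.) Let $\mathcal{C}\subseteq\mathbb{F}^I$ be a linear code, let $\mathcal{G}=(V,E)$ be a connected graph, and let $\Gamma=(\mathcal{G},\omega,(\mathcal{S}_e)_{e\in E},(C_v)_{v\in V})$ be a graphical realization of $\mathcal{C}$ on $\mathcal{G}$. If $(V_0,V_1,\ldots,V_\delta)$ (with $\delta\ge 0$) is a star partition of $V$, then, defining $J_i=\omega^{-1}(V_i)$ for $i=1,\ldots,\delta$, $$\sum_{v\in V_0}\dim(C_v)\;\ge\;\dim(\mathcal{C})-\sum_{i=1}^{\delta}\dim(\mathcal{C}_{J_i}).$$
   Context: $\mathbb{F}$ is a finite field and $I$ a finite index set; a linear code on $I$ is a subspace $\mathcal{C}\subseteq\mathbb{F}^I$. For $\mathbf{x}\in\mathbb{F}^I$ and $J\subseteq I$, $\mathbf{x}|_J=(x_i)_{i\in J}$. The cross-section of $\mathcal{C}$ on $J$ is $\mathcal{C}_J=\{\mathbf{c}|_J:\mathbf{c}\in\mathcal{C},\ \mathbf{c}|_{I\setminus J}=\mathbf{0}\}$. Graphs are finite. For a graph $\mathcal{G}=(V,E)$ and $v\in V$, $E(v)$ is the set of edges incident with $v$. A graphical model is a tuple $(\mathcal{G},\omega,(\mathcal{S}_e)_{e\in E},(C_v)_{v\in V})$ where $\mathcal{G}=(V,E)$ is a connected graph, $\omega:I\to V$ is any map, each $\mathcal{S}_e$ is a finite-dimensional $\mathbb{F}$-vector space, and each $C_v$ is a subspace of $\mathbb{F}^{\omega^{-1}(v)}\oplus\bigoplus_{e\in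 E(v)}\mathcal{S}_e$. Its full behavior $\mathfrak{B}$ is the set of all $\mathbf{b}=((x_i)_{i\in I},(\mathbf{s}_e)_{e\in E})\in\mathbb{F}^I\oplus\bigoplus_{e\in E}\mathcal{S}_e$ such that for every $v\in V$, $\mathbf{b}|_v:=((x_i)_{i\in\omega^{-1}(v)},(\mathbf{s}_e)_{e\in E(v)})\in C_v$. The model is essential if $\{\mathbf{b}|_v:\mathbf{b}\in\mathfrak{B}\}=C_v$ for all $v$ and $\{\mathbf{s}_e:\mathbf{b}\in\mathfrak{B}\}=\mathcal{S}_e$ for all $e$. A graphical realization of $\mathcal{C}$ (on $\mathcal{G}$, extending $(\mathcal{G},\omega)$) is an essential graphical model whose full behavior satisfies $\{(x_i)_{i\in I}:\mathbf{b}\in\mathfrak{B}\}=\mathcal{C}$. For $W\subseteq V$, $N(W)$ is the set of vertices adjacent (in $\mathcal{G}$) to some vertex of $W$. An ordered collection $(V_0,V_1,\ldots,V_\delta)$, $\delta\ge0$, of subsets of $V$ is a star partition of $V$ if the $V_i$ are pairwise disjoint (some possibly empty), their union is $V$, and $N(V_i)\subseteq V_i\cup V_0$ for each $i\in\{1,\ldots,\delta\}$. *)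

theory Defs
  imports "HOL-Analysis.Analysis" "HOL-Library.Function_Algebras"
begin

section \<open>Finite undirected graphs\<close>

text \<open>
  Edges are abstract objects with a set of end vertices, so parallel edges and self-loops
  (edges with a single end vertex) are allowed; for a simple graph take two-element vertex sets
  as edges and the identity for \<open>ends\<close>.
\<close>

record ('v, 'e) multigraph =
  verts :: "'v set"
  edges :: "'e set"
  ends :: "'e \<Rightarrow> 'v set"

definition finite_graph :: "('v, 'e, 'm) multigraph_scheme \<Rightarrow> bool" where
  "finite_graph G \<longleftrightarrow> finite (verts G) \<and> finite (edges G) \<and>
     (\<forall>e\<in>edges G. ends G e \<subseteq> verts G \<and> card (ends G e) \<in> {1, 2})"

definition adjacent :: "('v, 'e, 'm) multigraph_scheme \<Rightarrow> 'v \<Rightarrow> 'v \<Rightarrow> bool" where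
  "adjacent G u v \<longleftrightarrow> (\<exists>e\<in>edges G. ends G e = {u, v})"

definition connected_graph :: "('v, 'e, 'm) multigraph_scheme \<Rightarrow> bool" where
  "connected_graph G \<longleftrightarrow> finite_graph G \<and> verts G \<noteq> {} \<and>
     (\<forall>u\<in>verts G. \<forall>v\<in>verts G. (adjacent G)\<^sup>*\<^sup>* u v)"

definition incident_edges :: "('v, 'e, 'm) multigraph_scheme \<Rightarrow> 'v \<Rightarrow> 'e set" where
  "incident_edges G v = {e \<in> edges G. v \<in> ends G e}"

definition neighbours :: "('v, 'e, 'm) multigraph_scheme \<Rightarrow> 'v set \<Rightarrow> 'v set" where
  "neighbours G W = {u \<in> verts G. \<exists>w\<in>W. adjacent G w u}"

text \<open>The partition is \<open>Vs 0, \<dots>, Vs d\<close>; the values of \<open>Vs\<close> beyond \<open>d\<close> are irrelevant.\<close>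

definition star_partition ::
    "('v, 'e, 'm) multigraph_scheme \<Rightarrow> nat \<Rightarrow> (nat \<Rightarrow> 'v set) \<Rightarrow> bool" where
  "star_partition G d Vs \<longleftrightarrow>
     disjoint_family_on Vs {0..d} \<and> (\<Union>i\<in>{0..d}. Vs i) = verts G \<and>
     (\<forall>i\<in>{1..d}. neighbours G (Vs i) \<subseteq> Vs i \<union> Vs 0)"

section \<open>Linear codes\<close>

text \<open>
  For an index set \<open>J\<close>, an element of a product indexed by \<open>J\<close> is represented by a total function
  vanishing outside \<open>J\<close>, so that all such products are subspaces of one function space.
  Restriction to \<open>J\<close> sets the remaining coordinates to zero.
\<close>

definition supported_on :: "'a set \<Rightarrow> ('a \<Rightarrow> 'b::zero) set" where
  "supported_on J = {x. \<forall>i. i \<notin> J \<longrightarrow> x i = 0}"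

definition restr :: "'a set \<Rightarrow> ('a \<Rightarrow> 'b::zero) \<Rightarrow> 'a \<Rightarrow> 'b" where
  "restr J x = (\<lambda>i. if i \<in> J then x i else 0)"

definition fun_scale :: "('f \<Rightarrow> 'b \<Rightarrow> 'b) \<Rightarrow> 'f \<Rightarrow> ('a \<Rightarrow> 'b) \<Rightarrow> 'a \<Rightarrow> 'b" where
  "fun_scale sc a x = (\<lambda>i. sc a (x i))"

lemma vector_space_fun_scale:
  assumes "vector_space sc"
  shows "vector_space (fun_scale sc)"
proof -
  interpret vector_space sc by (fact assms)
  show ?thesis
    by unfold_locales
      (auto simp: fun_scale_def fun_eq_iff scale_right_distrib scale_left_distrib)
qed

abbreviation word_scale :: "'f::field \<Rightarrow> ('i \<Rightarrow> 'f) \<Rightarrow> 'i \<Rightarrow> 'f" where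
  "word_scale \<equiv> fun_scale (*)"

lemma vector_space_word_scale: "vector_space (word_scale :: 'f::field \<Rightarrow> ('i \<Rightarrow> 'f) \<Rightarrow> _)"
  by (rule vector_space_fun_scale) (unfold_locales, auto simp: algebra_simps)

abbreviation code_dim :: "('i \<Rightarrow> 'f::field) set \<Rightarrow> nat" where
  "code_dim \<equiv> vector_space.dim word_scale"

definition linear_code :: "'i set \<Rightarrow> ('i \<Rightarrow> 'f::field) set \<Rightarrow> bool" where
  "linear_code I C \<longleftrightarrow> C \<subseteq> supported_on I \<and> module.subspace word_scale C"

definition cross_section :: "'i set \<Rightarrow> ('i \<Rightarrow> 'f::field) set \<Rightarrow> 'i set \<Rightarrow> ('i \<Rightarrow> 'f) set" where
  "cross_section I C J = {restr J c |c. c \<in> C \<and> restr (I - J) c = 0}"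

section \<open>Graphical models\<close>

text \<open>
  The state spaces are finite-dimensional subspaces of a common vector space of type \<open>'s\<close> with
  scalar multiplication \<open>state_scale\<close>. This is no restriction: any finite family of vector spaces
  embeds into its direct sum.

  A configuration is a pair of a family of symbols and a family of states.
\<close>

record ('v, 'e, 'i, 'f, 's) graphical_model = "('v, 'e) multigraph" +
  indices :: "'i set"
  index_map :: "'i \<Rightarrow> 'v"
  state_scale :: "'f \<Rightarrow> 's \<Rightarrow> 's"
  state_space :: "'e \<Rightarrow> 's set"
  constraint :: "'v \<Rightarrow> (('i \<Rightarrow> 'f) \<times> ('e \<Rightarrow> 's)) set"

text \<open>\<open>fibre M W\<close> is the preimage of \<open>W\<close> under the index map.\<close>

definition fibre ::
    "('v, 'e, 'i, 'f, 's) graphical_model \<Rightarrow> 'v set \<Rightarrow> 'i set" where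
  "fibre M W = {i \<in> indices M. index_map M i \<in> W}"

definition config_scale ::
    "('v, 'e, 'i, 'f::field, 's::ab_group_add) graphical_model \<Rightarrow>
     'f \<Rightarrow> ('i \<Rightarrow> 'f) \<times> ('e \<Rightarrow> 's) \<Rightarrow> ('i \<Rightarrow> 'f) \<times> ('e \<Rightarrow> 's)" where
  "config_scale M = module_prod.scale word_scale (fun_scale (state_scale M))"

lemma vector_space_config_scale:
  assumes "vector_space (state_scale M)"
  shows "vector_space (config_scale M)"
proof -
  interpret vector_space_prod word_scale "fun_scale (state_scale M)"
    by (intro vector_space_prod.intro vector_space_pair.intro vector_space_word_scale
        vector_space_fun_scale assms)
  show ?thesis
    unfolding config_scale_def by (rule p.vector_space_axioms)
qed

text \<open>Configurations with symbols indexed by \<open>J\<close> and states indexed by \<open>F\<close>.\<close>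

definition config_space ::
    "('v, 'e, 'i, 'f::field, 's::ab_group_add) graphical_model \<Rightarrow> 'i set \<Rightarrow> 'e set \<Rightarrow>
     (('i \<Rightarrow> 'f) \<times> ('e \<Rightarrow> 's)) set" where
  "config_space M J F =
     {(x, s). x \<in> supported_on J \<and> s \<in> supported_on F \<and> (\<forall>e\<in>F. s e \<in> state_space M e)}"

definition local_restr ::
    "('v, 'e, 'i, 'f::field, 's::ab_group_add) graphical_model \<Rightarrow> 'v \<Rightarrow>
     ('i \<Rightarrow> 'f) \<times> ('e \<Rightarrow> 's) \<Rightarrow> ('i \<Rightarrow> 'f) \<times> ('e \<Rightarrow> 's)" where
  "local_restr M v b = (restr (fibre M {v}) (fst b), restr (incident_edges M v) (snd b))"

definition is_graphical_model ::
    "('v, 'e, 'i, 'f::field, 's::ab_group_add) graphical_model \<Rightarrow> bool" where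
  "is_graphical_model M \<longleftrightarrow>
     connected_graph M \<and>
     finite (indices M) \<and> index_map M \<in> indices M \<rightarrow> verts M \<and>
     vector_space (state_scale M) \<and>
     (\<forall>e\<in>edges M. module.subspace (state_scale M) (state_space M e) \<and>
        (\<exists>B. finite B \<and> module.span (state_scale M) B = state_space M e)) \<and>
     (\<forall>v\<in>verts M. module.subspace (config_scale M) (constraint M v) \<and>
        constraint M v \<subseteq> config_space M (fibre M {v}) (incident_edges M v))"

definition full_behavior ::
    "('v, 'e, 'i, 'f::field, 's::ab_group_add) graphical_model \<Rightarrow>
     (('i \<Rightarrow> 'f) \<times> ('e \<Rightarrow> 's)) set" where
  "full_behavior M =
     {b \<in> config_space M (indices M) (edges M). \<forall>v\<in>verts M. local_restr M v b \<in> constraint M v}"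

definition essential ::
    "('v, 'e, 'i, 'f::field, 's::ab_group_add) graphical_model \<Rightarrow> bool" where
  "essential M \<longleftrightarrow>
     (\<forall>v\<in>verts M. local_restr M v ` full_behavior M = constraint M v) \<and>
     (\<forall>e\<in>edges M. (\<lambda>b. snd b e) ` full_behavior M = state_space M e)"

definition graphical_realization ::
    "('v, 'e, 'i, 'f::field, 's::ab_group_add) graphical_model \<Rightarrow> ('i \<Rightarrow> 'f) set \<Rightarrow> bool" where
  "graphical_realization M C \<longleftrightarrow>
     is_graphical_model M \<and> essential M \<and> fst ` full_behavior M = C"

definition constraint_dim ::
    "('v, 'e, 'i, 'f::field, 's::ab_group_add) graphical_model \<Rightarrow> 'v \<Rightarrow> nat" where
  "constraint_dim M v = vector_space.dim (config_scale M) (constraint M v)"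

end

theory Submission
  imports Defs
begin

text \<open>
  Everything in sight is finite, so dimensions can be compared by counting. Choose for every
  codeword a configuration of the full behavior projecting to it, and record the local
  configurations on \<open>V\<^sub>0\<close>. Two codewords with the same record differ by the
  projection of a configuration that vanishes at \<open>V\<^sub>0\<close>. As edges leaving \<open>V\<^sub>i\<close> end in \<open>V\<^sub>0\<close>, such a
  configuration may be cut off outside \<open>V\<^sub>i\<close> without leaving the full behavior, so its
  restriction to \<open>J\<^sub>i\<close> is in the cross-section. Hence \<open>card C\<close> is at most the product of the
  cardinalities of the constraint codes at \<open>V\<^sub>0\<close> and of the cross-sections on the \<open>J\<^sub>i\<close>, and
  taking logarithms to the base of the field size gives the bound.
\<close>

section \<open>Cardinality and dimension over a finite field\<close>

context vector_space
begin

text \<open>Prepares induction on a spanning set: being an image of a product, the span stays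
  finite, and its size is multiplied by the field size whenever the map is injective.\<close>

lemma span_insert_eq_image: "span (insert a S) = (\<lambda>(k, x). scale k a + x) ` (UNIV \<times> span S)"
proof (intro set_eqI iffI)
  fix y assume "y \<in> span (insert a S)"
  then obtain k where "y - scale k a \<in> span S"
    by (auto simp: span_breakdown_eq)
  then show "y \<in> (\<lambda>(k, x). scale k a + x) ` (UNIV \<times> span S)"
    by (intro image_eqI[of _ _ "(k, y - scale k a)"]) auto
next
  fix y assume "y \<in> (\<lambda>(k, x). scale k a + x) ` (UNIV \<times> span S)"
  then obtain k x where "y = scale k a + x" "x \<in> span S"
    by auto
  then show "y \<in> span (insert a S)"
    by (auto simp: span_breakdown_eq intro!: exI[of _ k])
qed

lemma finite_span:
  assumes "finite (UNIV :: 'a set)" "finite S"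
  shows "finite (span S)"
  using assms(2) by induction (auto simp: span_insert_eq_image assms(1))

lemma card_span_independent:
  assumes "finite (UNIV :: 'a set)" "finite S" "independent S"
  shows "card (span S) = CARD('a) ^ card S"
  using assms(2,3)
proof induction
  case empty
  then show ?case by simp
next
  case (insert a S)
  then have a: "a \<notin> span S" and ind: "independent S"
    by (simp_all add: independent_insert)
  have "inj_on (\<lambda>(k, x). scale k a + x) (UNIV \<times> span S)"
  proof (rule inj_onI, clarify)
    fix k x l y
    assume x: "x \<in> span S" and y: "y \<in> span S" and eq: "scale k a + x = scale l a + y"
    have "scale (k - l) a = y - x"
      using eq by (simp add: scale_left_diff_distrib algebra_simps)
    then have "scale (k - l) a \<in> span S"
      using x y by (simp add: span_diff)
    \<comment> \<open>If \<open>k\<close> and \<open>l\<close> differed, dividing by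
      \<open>k - l\<close> would put \<open>a\<close> itself into \<open>span S\<close>.\<close>
    then have "scale (inverse (k - l)) (scale (k - l) a) \<in> span S"
      by (rule span_scale)
    then have "k = l"
      using a by (cases "k = l") (simp_all del: scale_left_diff_distrib)
    with eq show "k = l \<and> x = y" by simp
  qed
  then have "card (span (insert a S)) = CARD('a) * card (span S)"
    by (simp add: span_insert_eq_image card_image card_cartesian_product)
  then show ?case
    using insert ind by simp
qed

text \<open>\<open>S\<close> lies in the span of \<open>dim S\<close> independent vectors. Stated
  for arbitrary finite sets, so that it applies to cross-sections without first proving them to be
  subspaces.\<close>

lemma card_le_power_dim:
  assumes "finite (UNIV :: 'a set)" "finite S"
  shows "card S \<le> CARD('a) ^ dim S"
proof -
  obtain B where B: "B \<subseteq> S" "independent B" "S \<subseteq> span B" "card B = dim S"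
    using basis_exists by metis
  have fin: "finite B"
    using B(1) assms(2) finite_subset by blast
  show ?thesis
    using card_mono[OF finite_span[OF assms(1) fin] B(3)]
      card_span_independent[OF assms(1) fin B(2)] B(4) by simp
qed

lemma power_dim_eq_card:
  assumes "finite (UNIV :: 'a set)" "finite S" "subspace S"
  shows "CARD('a) ^ dim S = card S"
proof -
  obtain B where B: "B \<subseteq> S" "independent B" "S \<subseteq> span B" "card B = dim S"
    using basis_exists by metis
  have fin: "finite B"
    using B(1) assms(2) finite_subset by blast
  have "span B = S"
    using B(1,3) assms(3) by (rule span_subspace)
  then show ?thesis
    using card_span_independent[OF assms(1) fin B(2)] B(4) by simp
qed

end

section \<open>Functions with finite support\<close>

text \<open>\<open>restrict\<close> trades the default value 0 outside \<open>F\<close> for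
  \<open>undefined\<close>, which carries finiteness over from \<open>PiE\<close>; it loses nothing,
  since the functions all vanish outside \<open>F\<close>.\<close>

lemma finite_supported_on:
  assumes "finite F" "\<And>e. e \<in> F \<Longrightarrow> finite (A e)"
  shows "finite {s \<in> supported_on F. \<forall>e\<in>F. s e \<in> A e}"
proof (rule finite_imageD)
  show "finite ((\<lambda>s. restrict s F) ` {s \<in> supported_on F. \<forall>e\<in>F. s e \<in> A e})"
    by (rule finite_subset[OF _ finite_PiE[OF assms]]) auto
  show "inj_on (\<lambda>s. restrict s F) {s \<in> supported_on F. \<forall>e\<in>F. s e \<in> A e}"
  proof (rule inj_onI, rule ext)
    fix s t e
    assume st: "s \<in> {s \<in> supported_on F. \<forall>e\<in>F. s e \<in> A e}" "t \<in> {s \<in> supported_on F. \<forall>e\<in>F. s e \<in> A e}"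
      and eq: "restrict s F = restrict t F"
    show "s e = t e"
      using st fun_cong[OF eq, of e] by (cases "e \<in> F") (auto simp: supported_on_def)
  qed
qed

lemma finite_supported_on_UNIV:
  "finite I \<Longrightarrow> finite (supported_on I :: ('i \<Rightarrow> 'f::{zero, finite}) set)"
  using finite_supported_on[of I "\<lambda>_. UNIV :: 'f set"] by simp

lemma restr_diff:
  fixes x y :: "'a \<Rightarrow> 'b::ab_group_add"
  shows "restr J (x - y) = restr J x - restr J y"
  by (auto simp: restr_def fun_eq_iff)

section \<open>Full behaviors\<close>

lemma local_restr_diff: "local_restr M v (b - b') = local_restr M v b - local_restr M v b'"
  by (simp add: local_restr_def restr_diff)

lemma finite_config_space:
  fixes M :: "('v, 'e, 'i, 'f::{field, finite}, 's::ab_group_add) graphical_model"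
  assumes M: "is_graphical_model M" and "J \<subseteq> indices M" "F \<subseteq> edges M"
  shows "finite (config_space M J F)"
proof -
  interpret vector_space "state_scale M"
    using M by (simp add: is_graphical_model_def)
  have fin: "finite (indices M)" "finite (edges M)"
    using M by (auto simp: is_graphical_model_def connected_graph_def finite_graph_def)
  have state: "finite (state_space M e)" if "e \<in> F" for e
  proof -
    have "\<exists>B. finite B \<and> span B = state_space M e"
      using M subsetD[OF assms(3) that] by (simp add: is_graphical_model_def)
    then obtain B where B: "finite B" "span B = state_space M e"
      by blast
    show ?thesis
      using finite_span[OF finite B(1)] B(2) by simp
  qed
  have "config_space M J F =
      supported_on J \<times> {s \<in> supported_on F. \<forall>e\<in>F. s e \<in> state_space M e}"
    by (auto simp: config_space_def)
  moreover have "finite (supported_on J :: ('i \<Rightarrow> 'f) set)"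
    using fin(1) assms(2) by (intro finite_supported_on_UNIV) (rule finite_subset)
  moreover have "finite {s \<in> supported_on F. \<forall>e\<in>F. s e \<in> state_space M e}"
    using fin(2) assms(3) state by (intro finite_supported_on) (rule finite_subset)
  ultimately show ?thesis by simp
qed

lemma finite_constraint:
  fixes M :: "('v, 'e, 'i, 'f::{field, finite}, 's::ab_group_add) graphical_model"
  assumes M: "is_graphical_model M" and "v \<in> verts M"
  shows "finite (constraint M v)"
proof (rule finite_subset)
  show "constraint M v \<subseteq> config_space M (fibre M {v}) (incident_edges M v)"
    using assms by (auto simp: is_graphical_model_def)
  show "finite (config_space M (fibre M {v}) (incident_edges M v))"
    by (rule finite_config_space[OF M]) (auto simp: fibre_def incident_edges_def)
qed

lemma full_behavior_diff:
  assumes M: "is_graphical_model M" and b: "b \<in> full_behavior M" and b': "b' \<in> full_behavior M"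
  shows "b - b' \<in> full_behavior M"
proof -
  have vs: "vector_space (state_scale M)"
    using M by (simp add: is_graphical_model_def)
  interpret S: vector_space "state_scale M" by (rule vs)
  interpret P: vector_space "config_scale M" by (rule vector_space_config_scale[OF vs])
  have "snd b e - snd b' e \<in> state_space M e" if "e \<in> edges M" for e
    using M b b' that
    by (intro S.subspace_diff)
      (auto simp: is_graphical_model_def full_behavior_def config_space_def)
  moreover have "local_restr M v (b - b') \<in> constraint M v" if "v \<in> verts M" for v
    unfolding local_restr_diff using M b b' that
    by (intro P.subspace_diff) (auto simp: is_graphical_model_def full_behavior_def)
  ultimately show ?thesis
    using b b'
    by (auto simp: full_behavior_def config_space_def supported_on_def minus_prod_def)
qed

text \<open>After the cut, each local configuration is either the old one (inside \<open>W\<close>)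
  or 0 (outside \<open>W\<close>), and both lie in the constraint code.\<close>

lemma full_behavior_cut:
  fixes M :: "('v, 'e, 'i, 'f::field, 's::ab_group_add) graphical_model"
  assumes M: "is_graphical_model M" and b: "b \<in> full_behavior M"
    and nb: "neighbours M W \<subseteq> W \<union> U"
    and zero: "\<And>v. v \<in> U \<Longrightarrow> local_restr M v b = 0"
  shows "(restr (fibre M W) (fst b), restr (\<Union>w\<in>W. incident_edges M w) (snd b))
           \<in> full_behavior M" (is "?b \<in> _")
proof -
  have vs: "vector_space (state_scale M)"
    using M by (simp add: is_graphical_model_def)
  interpret S: vector_space "state_scale M" by (rule vs)
  interpret P: vector_space "config_scale M" by (rule vector_space_config_scale[OF vs])
  have "local_restr M v ?b \<in> constraint M v" if v: "v \<in> verts M" for v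
  proof (cases "v \<in> W")
    case True
    then have "local_restr M v ?b = local_restr M v b"
      by (auto simp: local_restr_def restr_def fibre_def fun_eq_iff)
    then show ?thesis
      using b v by (simp add: full_behavior_def)
  next
    case False
    have "snd b e = 0" if w: "w \<in> W" and ew: "e \<in> incident_edges M w"
      and ev: "e \<in> incident_edges M v" for e w
    proof -
      have e: "e \<in> edges M" "{w, v} \<subseteq> ends M e" "w \<noteq> v"
        using w ew ev False by (auto simp: incident_edges_def)
      \<comment> \<open>An edge has at most two ends, so the distinct vertices \<open>w\<close> and
        \<open>v\<close> are all of them and are adjacent. Finiteness follows because
        \<open>card\<close> is 0 on infinite sets.\<close>
      have c: "card (ends M e) \<in> {1, 2}"
        using M e by (auto simp: is_graphical_model_def connected_graph_def finite_graph_def)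
      then have "finite (ends M e)"
        by (auto intro: card_ge_0_finite)
      then have "ends M e = {w, v}"
        using c e card_seteq[of "ends M e" "{w, v}"] by auto
      then have "v \<in> neighbours M W"
        using w v e by (auto simp: neighbours_def adjacent_def)
      \<comment> \<open>As a neighbour of \<open>W\<close> outside \<open>W\<close>, the vertex
        \<open>v\<close> belongs to \<open>U\<close>.\<close>
      then have "local_restr M v b = 0"
        using nb zero False by auto
      then have "restr (incident_edges M v) (snd b) e = 0"
        by (simp add: local_restr_def zero_prod_def)
      then show ?thesis
        using ev by (simp add: restr_def)
    qed
    \<comment> \<open>At \<open>v\<close>, symbols and edges not meeting \<open>W\<close> have been
      cut off, and edges meeting \<open>W\<close> carry state 0.\<close>
    then have "local_restr M v ?b = 0"
      using False by (auto simp: local_restr_def restr_def fibre_def fun_eq_iff zero_prod_def)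
    then show ?thesis
      using M v P.subspace_0 by (auto simp: is_graphical_model_def)
  qed
  moreover have "restr (\<Union>w\<in>W. incident_edges M w) (snd b) e \<in> state_space M e"
    if "e \<in> edges M" for e
    using M b that S.subspace_0
    by (auto simp: is_graphical_model_def full_behavior_def config_space_def restr_def)
  ultimately show ?thesis
    using b
    by (auto simp: full_behavior_def config_space_def supported_on_def restr_def fibre_def
        incident_edges_def)
qed

text \<open>The cut configuration projects to a codeword that already vanishes outside the fibre, so
  this codeword is its own witness.\<close>

lemma restr_in_cross_section:
  assumes M: "is_graphical_model M" and b: "b \<in> full_behavior M"
    and nb: "neighbours M W \<subseteq> W \<union> U"
    and zero: "\<And>v. v \<in> U \<Longrightarrow> local_restr M v b = 0"
  shows "restr (fibre M W) (fst b)
           \<in> cross_section (indices M) (fst ` full_behavior M) (fibre M W)"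
proof -
  let ?c = "restr (fibre M W) (fst b)"
  have "?c \<in> fst ` full_behavior M"
    using full_behavior_cut[OF assms] by force
  moreover have "restr (fibre M W) ?c = ?c" "restr (indices M - fibre M W) ?c = 0"
    by (auto simp: restr_def fun_eq_iff)
  ultimately show ?thesis
    unfolding cross_section_def by (intro CollectI exI[of _ ?c]) simp
qed

lemma card_code_le:
  fixes M :: "('v, 'e, 'i, 'f::{field, finite}, 's::ab_group_add) graphical_model"
  assumes M: "is_graphical_model M" and C: "fst ` full_behavior M = C"
    and star: "star_partition M d Vs"
  shows "card C \<le> (\<Prod>v\<in>Vs 0. card (constraint M v)) *
           (\<Prod>i\<in>{1..d}. card (cross_section (indices M) C (fibre M (Vs i))))"
proof -
  let ?J = "\<lambda>i. fibre M (Vs i)"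
  let ?A = "\<Pi>\<^sub>E v\<in>Vs 0. constraint M v"
  let ?D = "\<Pi>\<^sub>E i\<in>{1..d}. cross_section (indices M) C (?J i)"
  have fin: "finite (indices M)" "finite (verts M)"
    using M by (auto simp: is_graphical_model_def connected_graph_def finite_graph_def)
  have nb: "neighbours M (Vs i) \<subseteq> Vs i \<union> Vs 0" if "i \<in> {1..d}" for i
    using star that by (auto simp: star_partition_def)
  have cover: "(\<Union>i\<in>{0..d}. Vs i) = verts M" and V0: "Vs 0 \<subseteq> verts M"
    using star by (auto simp: star_partition_def)
  have finV0: "finite (Vs 0)"
    using V0 fin(2) by (rule finite_subset)
  have supp: "C \<subseteq> supported_on (indices M)"
    using C by (auto simp: full_behavior_def config_space_def)

  \<comment> \<open>An arbitrary section of the projection, possibly not linear; linearity enters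
    only through differences inside the full behavior.\<close>
  define lift where "lift = inv_into (full_behavior M) fst"
  have lift: "lift c \<in> full_behavior M" "fst (lift c) = c" if "c \<in> C" for c
    using that unfolding lift_def C[symmetric] by (fact inv_into_into f_inv_into_f)+
  define g where "g c = (\<lambda>v\<in>Vs 0. local_restr M v (lift c))" for c
  \<comment> \<open>One codeword for each record. It depends on \<open>c\<close> only through
    \<open>g c\<close>, so equal records mean equal representatives, and \<open>c\<close> is
    determined by its record and its difference from \<open>rep c\<close>.\<close>
  define rep where "rep c = inv_into C g (g c)" for c
  have rep: "rep c \<in> C" "g (rep c) = g c" if "c \<in> C" for c
    using that unfolding rep_def by (simp_all add: inv_into_into f_inv_into_f)
  define h where "h c = (g c, \<lambda>i\<in>{1..d}. restr (?J i) (c - rep c))" for c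

  have "inj_on h C"
  proof (rule inj_onI, rule ext)
    fix c c' i
    assume cC: "c \<in> C" "c' \<in> C" and eq: "h c = h c'"
    have g: "g c = g c'" and r: "rep c = rep c'"
      and D: "(\<lambda>i\<in>{1..d}. restr (?J i) (c - rep c)) = (\<lambda>i\<in>{1..d}. restr (?J i) (c' - rep c'))"
      using eq by (auto simp: h_def rep_def)
    show "c i = c' i"
    proof (cases "i \<in> indices M")
      case False
      then show ?thesis
        using subsetD[OF supp cC(1)] subsetD[OF supp cC(2)] by (simp add: supported_on_def)
    next
      case True
      then have "index_map M i \<in> verts M"
        using M by (auto simp: is_graphical_model_def)
      then obtain k where k: "k \<le> d" "index_map M i \<in> Vs k"
        unfolding cover[symmetric] by auto
      show ?thesis
      \<comment> \<open>A symbol at \<open>Vs 0\<close> is read off the record; a symbol at another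
        part is read off the difference from the common representative.\<close>
      proof (cases "k = 0")
        case True
        let ?v = "index_map M i"
        have "local_restr M ?v (lift c) = local_restr M ?v (lift c')"
          using fun_cong[OF g, of ?v] k True by (simp add: g_def)
        then have "restr (fibre M {?v}) c i = restr (fibre M {?v}) c' i"
          using lift cC by (simp add: local_restr_def)
        then show ?thesis
          using \<open>i \<in> indices M\<close> by (simp add: restr_def fibre_def)
      next
        case False
        then have "restr (?J k) (c - rep c) i = restr (?J k) (c' - rep c') i"
          using fun_cong[OF D, of k] k by simp
        then show ?thesis
          using k \<open>i \<in> indices M\<close> r by (simp add: restr_def fibre_def)
      qed
    qed
  qed
  moreover have "h ` C \<subseteq> ?A \<times> ?D"
  proof (rule image_subsetI)
    fix c assume c: "c \<in> C"
    have "g c \<in> ?A"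
      using lift(1)[OF c] V0 by (auto simp: g_def full_behavior_def)
    moreover have "restr (?J i) (c - rep c) \<in> cross_section (indices M) C (?J i)"
      if i: "i \<in> {1..d}" for i
    proof -
      \<comment> \<open>Equal records make this difference of lifts vanish at \<open>Vs 0\<close>,
        while it still projects to \<open>c - rep c\<close>. The lift of \<open>c - rep c\<close>
        could fail to vanish there.\<close>
      let ?b = "lift c - lift (rep c)"
      have "?b \<in> full_behavior M"
        using full_behavior_diff[OF M] lift c rep by blast
      moreover have "local_restr M v ?b = 0" if "v \<in> Vs 0" for v
        using fun_cong[OF rep(2)[OF c], of v] that by (simp add: g_def local_restr_diff)
      ultimately have "restr (?J i) (fst ?b) \<in> cross_section (indices M) C (?J i)"
        using restr_in_cross_section[OF M _ nb[OF i]] C by blast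
      then show ?thesis
        using lift c rep by simp
    qed
    ultimately show "h c \<in> ?A \<times> ?D"
      by (auto simp: h_def)
  qed
  moreover have "finite (?A \<times> ?D)"
  proof (intro finite_cartesian_product finite_PiE finV0)
    show "finite (constraint M v)" if "v \<in> Vs 0" for v
      using finite_constraint[OF M] V0 that by blast
  next
    fix i
    have "finite C"
      using supp finite_supported_on_UNIV[OF fin(1)] by (rule finite_subset)
    then show "finite (cross_section (indices M) C (?J i))"
      by (simp add: cross_section_def)
  qed simp
  ultimately have "card C \<le> card (?A \<times> ?D)"
    by (rule card_inj_on_le)
  then show ?thesis
    by (simp add: card_cartesian_product card_PiE finV0)
qed

theorem theorem4p3:
  fixes \<Gamma> :: "('v, 'e, 'i, 'f::{field, finite}, 's::ab_group_add) graphical_model"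
    and C :: "('i \<Rightarrow> 'f) set"
    and Vs :: "nat \<Rightarrow> 'v set"
    and \<delta> :: nat
  assumes "linear_code (indices \<Gamma>) C"
    and "graphical_realization \<Gamma> C"
    and "star_partition \<Gamma> \<delta> Vs"
  shows "(\<Sum>v\<in>Vs 0. int (constraint_dim \<Gamma> v)) \<ge>
           int (code_dim C)
             - (\<Sum>i=1..\<delta>. int (code_dim (cross_section (indices \<Gamma>) C (fibre \<Gamma> (Vs i)))))"
proof -
  let ?X = "\<lambda>i. cross_section (indices \<Gamma>) C (fibre \<Gamma> (Vs i))"
  let ?q = "CARD('f)"
  have M: "is_graphical_model \<Gamma>" and C: "fst ` full_behavior \<Gamma> = C"
    using assms(2) by (auto simp: graphical_realization_def)
  have vs: "vector_space (config_scale \<Gamma>)"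
    using M by (intro vector_space_config_scale) (simp add: is_graphical_model_def)
  have V0: "Vs 0 \<subseteq> verts \<Gamma>"
    using assms(3) by (auto simp: star_partition_def)
  have "finite (indices \<Gamma>)"
    using M by (simp add: is_graphical_model_def)
  then have finC: "finite C"
    using assms(1) finite_supported_on_UNIV finite_subset by (fastforce simp: linear_code_def)
  \<comment> \<open>The elements 0 and 1 are distinct; a base above 1 allows exponents to be
    compared at the end.\<close>
  have q: "?q > 1"
    using card_mono[of UNIV "{0, 1 :: 'f}"] by simp
  have constraint: "card (constraint \<Gamma> v) \<le> ?q ^ constraint_dim \<Gamma> v" if "v \<in> Vs 0" for v
    unfolding constraint_dim_def
    using finite_constraint[OF M] V0 that
    by (intro vector_space.card_le_power_dim[OF vs]) auto
  have cross: "card (?X i) \<le> ?q ^ code_dim (?X i)" for i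
    using finC
    by (intro vector_space.card_le_power_dim[OF vector_space_word_scale])
      (auto simp: cross_section_def)
  \<comment> \<open>The chain starts from the code, whose dimension must be bounded from above,
    hence the exact count for the subspace \<open>C\<close>; the factors on the other side are only
    bounded above by powers.\<close>
  have "?q ^ code_dim C = card C"
    using assms(1) finC
    by (intro vector_space.power_dim_eq_card[OF vector_space_word_scale])
      (auto simp: linear_code_def)
  also have "\<dots> \<le> (\<Prod>v\<in>Vs 0. card (constraint \<Gamma> v)) * (\<Prod>i\<in>{1..\<delta>}. card (?X i))"
    by (rule card_code_le[OF M C assms(3)])
  also have "\<dots> \<le> (\<Prod>v\<in>Vs 0. ?q ^ constraint_dim \<Gamma> v) * (\<Prod>i\<in>{1..\<delta>}. ?q ^ code_dim (?X i))"
    by (intro mult_mono prod_mono) (auto simp: constraint cross)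
  also have "\<dots> = ?q ^ ((\<Sum>v\<in>Vs 0. constraint_dim \<Gamma> v) + (\<Sum>i=1..\<delta>. code_dim (?X i)))"
    by (simp add: power_add power_sum)
  finally have "code_dim C \<le> (\<Sum>v\<in>Vs 0. constraint_dim \<Gamma> v) + (\<Sum>i=1..\<delta>. code_dim (?X i))"
    using q by (simp only: power_increasing_iff)
  then have "int (code_dim C) \<le> int ((\<Sum>v\<in>Vs 0. constraint_dim \<Gamma> v) + (\<Sum>i=1..\<delta>. code_dim (?X i)))"
    by (simp only: of_nat_le_iff)
  then show ?thesis
    by simp
qed

end
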